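(* Let $\mathfrak{g}=\bigoplus_{j=1}^k\mathfrak{g}_j$ be a complex Lie algebra given as a direct sum of indecomposable ideals $\mathfrak{g}_j$ with $[\mathfrak{g}_j,\mathfrak{g}_j]\neq0$ for all $j$. For every $1\le l\le k$ there exists an inner product on the underlying real Lie algebra of $\mathfrak{g}$ such that it has exactly $2^l$ orthogonal bi-invariant complex structures.
   Context: All Lie algebras are finite-dimensional. A (complex) Lie algebra is indecomposable if it cannot be written as a direct sum of (complex) ideals $\mathfrak{g}_1\oplus\mathfrak{g}_2$ with $\mathfrak{g}_1\neq0\neq\mathfrak{g}_2$. The underlying real Lie algebra of a complex Lie algebra is obtained by restricting scalars to $\mathbb{R}$. An inner product on a real Lie algebra is a positive definite symmetric bilinear form. An orthogonal bi-invariant complex structure on a real Lie algebra $\mathfrak{h}$ with inner product $\langle\cdot,\cdot\rangle$ is an $\mathbb{R}$-linear map $J:\mathfrak{h}\to\mathfrak{h}$ with $J^2=-\mathrm{Id}$, $J([X,Y])=[J(X),Y]$ and $\langle J(X),J(Y)\rangle=\langle X,Y\rangle$ for all $X,Y\in\mathfrak{h}$. *)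

theory Defs
  imports Complex_Main "HOL-Library.FuncSet" "HOL-Library.Set_Algebras"
begin

definition bilinear_map ::
  "('f::field \<Rightarrow> 'a::ab_group_add \<Rightarrow> 'a) \<Rightarrow> ('f \<Rightarrow> 'b::ab_group_add \<Rightarrow> 'b) \<Rightarrow> ('a \<Rightarrow> 'a \<Rightarrow> 'b) \<Rightarrow> bool"
where
  "bilinear_map s t f \<longleftrightarrow>
     (\<forall>x. Vector_Spaces.linear s t (\<lambda>y. f x y)) \<and> (\<forall>y. Vector_Spaces.linear s t (\<lambda>x. f x y))"

locale lie_algebra = vector_space scale
  for scale :: "'f::field \<Rightarrow> 'a::ab_group_add \<Rightarrow> 'a" +
  fixes bracket :: "'a \<Rightarrow> 'a \<Rightarrow> 'a"
  assumes bracket_bilinear: "bilinear_map scale scale bracket"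
    and bracket_self: "bracket x x = 0"
    and jacobi: "bracket x (bracket y z) + bracket y (bracket z x) + bracket z (bracket x y) = 0"
begin

text \<open>The ambient Lie algebra is the whole type. The argument \<open>L\<close> below is a subalgebra, regarded
  as a Lie algebra in its own right; \<open>L = UNIV\<close> is the ambient one.\<close>

definition ideal :: "'a set \<Rightarrow> 'a set \<Rightarrow> bool" where
  "ideal L I \<longleftrightarrow> subspace I \<and> I \<subseteq> L \<and> (\<forall>x\<in>L. \<forall>y\<in>I. bracket x y \<in> I)"

definition derived :: "'a set \<Rightarrow> 'a set" where
  "derived L = span {bracket x y | x y. x \<in> L \<and> y \<in> L}"

definition indecomposable :: "'a set \<Rightarrow> bool" where
  "indecomposable L \<longleftrightarrow>
     \<not> (\<exists>A B. ideal L A \<and> ideal L B \<and> A \<noteq> {0} \<and> B \<noteq> {0} \<and> A + B = L \<and> A \<inter> B = {0})"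

definition direct_sum_of_ideals :: "'i set \<Rightarrow> ('i \<Rightarrow> 'a set) \<Rightarrow> bool" where
  "direct_sum_of_ideals J G \<longleftrightarrow>
     finite J \<and> (\<forall>j\<in>J. ideal UNIV (G j)) \<and> (\<forall>x. \<exists>!f. f \<in> (\<Pi>\<^sub>E j\<in>J. G j) \<and> x = (\<Sum>j\<in>J. f j))"

end

locale finite_dimensional_lie_algebra = lie_algebra +
  assumes finite_dimensional: "\<exists>B. finite B \<and> span B = UNIV"

definition restrict_scalars :: "(complex \<Rightarrow> 'a \<Rightarrow> 'a) \<Rightarrow> real \<Rightarrow> 'a \<Rightarrow> 'a" where
  "restrict_scalars s = (\<lambda>r x. s (complex_of_real r) x)"

definition inner_product :: "(real \<Rightarrow> 'a::ab_group_add \<Rightarrow> 'a) \<Rightarrow> ('a \<Rightarrow> 'a \<Rightarrow> real) \<Rightarrow> bool" where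
  "inner_product s ip \<longleftrightarrow>
     bilinear_map s (*) ip \<and> (\<forall>x y. ip x y = ip y x) \<and> (\<forall>x. x \<noteq> 0 \<longrightarrow> ip x x > 0)"

definition orthogonal_biinvariant_complex_structure ::
  "(real \<Rightarrow> 'a::ab_group_add \<Rightarrow> 'a) \<Rightarrow> ('a \<Rightarrow> 'a \<Rightarrow> 'a) \<Rightarrow> ('a \<Rightarrow> 'a \<Rightarrow> real) \<Rightarrow> ('a \<Rightarrow> 'a) \<Rightarrow> bool"
where
  "orthogonal_biinvariant_complex_structure s br ip J \<longleftrightarrow>
     Vector_Spaces.linear s s J \<and>
     (\<forall>x. J (J x) = - x) \<and>
     (\<forall>x y. J (br x y) = br (J x) y) \<and>
     (\<forall>x y. ip (J x) (J y) = ip x y)"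

lemma linear_restrict_scalars:
  assumes "Vector_Spaces.linear s t f"
  shows "Vector_Spaces.linear (restrict_scalars s) (restrict_scalars t) f"
proof -
  interpret Vector_Spaces.linear s t f by fact
  show ?thesis
    by unfold_locales
      (simp_all add: restrict_scalars_def add scale vs1.scale_right_distrib vs1.scale_left_distrib
        vs2.scale_right_distrib vs2.scale_left_distrib)
qed

lemma finite_dimensional_lie_algebra_restrict_scalars:
  assumes "finite_dimensional_lie_algebra s br"
  shows "finite_dimensional_lie_algebra (restrict_scalars s) br"
proof -
  interpret finite_dimensional_lie_algebra s br by fact
  interpret R: vector_space "restrict_scalars s"
    by unfold_locales
      (simp_all add: restrict_scalars_def scale_right_distrib scale_left_distrib)
  obtain B where B: "finite B" "span B = UNIV"
    using finite_dimensional by blast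
  let ?C = "B \<union> s \<i> ` B"
  have i: "s \<i> x \<in> R.span ?C" if "x \<in> R.span ?C" for x
    using that
  proof (induction rule: R.span_induct_alt)
    case base
    show ?case by (simp add: R.span_zero)
  next
    case (step c b y)
    have "s \<i> b \<in> R.span ?C"
    proof (cases "b \<in> B")
      case True
      then show ?thesis by (auto intro: R.span_base)
    next
      case False
      with step obtain b' where b': "b' \<in> B" "b = s \<i> b'" by blast
      then have "s \<i> b = - b'" by simp
      with b' show ?thesis by (simp add: R.span_neg R.span_base)
    qed
    moreover have "s \<i> (restrict_scalars s c b + y) = restrict_scalars s c (s \<i> b) + s \<i> y"
      by (simp add: restrict_scalars_def scale_right_distrib mult.commute)
    ultimately show ?case
      using step by (simp add: R.span_add R.span_scale)
  qed
  have "subspace (R.span ?C)"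
  proof (rule subspaceI)
    fix c x assume x: "x \<in> R.span ?C"
    have "s c x = restrict_scalars s (Re c) x + restrict_scalars s (Im c) (s \<i> x)"
      by (simp add: restrict_scalars_def flip: scale_left_distrib)
        (metis complex_eq mult.commute)
    then show "s c x \<in> R.span ?C"
      using x i by (simp add: R.span_add R.span_scale)
  qed (simp_all add: R.span_zero R.span_add)
  then have "span B \<subseteq> R.span ?C"
    by (intro span_minimal) (auto intro: R.span_base)
  with B have "finite ?C \<and> R.span ?C = UNIV" by auto
  then show ?thesis
    using bracket_bilinear bracket_self jacobi
    by unfold_locales
      (auto simp: bilinear_map_def intro: linear_restrict_scalars)
qed

end

theory Submission
  imports Defs "HOL-Computational_Algebra.Fundamental_Theorem_Algebra"
begin

text \<open>Put the ideals \<open>\<gg>\<^sub>j\<close> into \<open>l\<close> nonempty blocks. The metric is chosen to be invariant under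
  multiplication by \<open>\<i>\<close>, to make different blocks orthogonal, and to make the derived algebras
  of two ideals in the same block non-orthogonal. Choosing a sign for each block and
  multiplying by \<open>\<plusminus>\<i>\<close> accordingly gives \<open>2\<^sup>l\<close> orthogonal bi-invariant complex structures. The work
  lies in showing that there are no others.

  Let \<open>J\<close> be such a structure. The operator \<open>T = J \<i> + \<i> J\<close> commutes with \<open>\<i>\<close> and with all adjoint
  maps, so it lies in the centroid of the complex Lie algebra. It is also symmetric, because \<open>J\<close>
  and \<open>\<i>\<close> are skew. Symmetric elements of the centroid are real scalars on each block
  (lemma \<open>symmetric_centroid_scalar_on_blocks\<close>), for three reasons:

  \<^item> By Fitting's lemma, an element of the centroid of an indecomposable Lie algebra over an
    algebraically closed field is a scalar plus a nilpotent element. A symmetric nilpotent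
    operator vanishes, so \<open>T\<close> is a real scalar \<open>r\<^sub>j\<close> on \<open>[\<gg>\<^sub>j,\<gg>\<^sub>j]\<close>.
  \<^item> Distinct eigenspaces of a symmetric operator are orthogonal, so \<open>r\<^sub>i = r\<^sub>j\<close> within a block.
  \<^item> For \<open>x\<close> in \<open>\<gg>\<^sub>j\<close> the vector \<open>w = T x - r\<^sub>j x\<close> is central. A central vector has its components
    in the \<open>[\<gg>\<^sub>i,\<gg>\<^sub>i]\<close>, since a central line outside the derived algebra would split off as an
    ideal. Symmetry of \<open>T\<close> then makes \<open>w\<close> orthogonal to all of its own components, so \<open>w = 0\<close>.

  Hence \<open>T = t\<close> on a block for some real \<open>t\<close>. On the derived algebra \<open>J\<close> commutes with \<open>\<i>\<close>, whence
  \<open>t\<^sup>2 = 4\<close>. Finally \<open>t \<bar>x\<bar>\<^sup>2 = \<langle>T x, x\<rangle> = - 2 \<langle>J x, \<i> x\<rangle>\<close> is the equality case of the Cauchy-Schwarz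
  inequality for \<open>J x\<close> and \<open>\<i> x\<close>, which forces \<open>J x = \<plusminus> \<i> x\<close> with one sign on the whole block.\<close>

section \<open>Endomorphisms of finite-dimensional vector spaces\<close>

text \<open>The value \<open>p(S) v\<close>, computed by Horner's scheme.\<close>

definition poly_action ::
  "('f::field \<Rightarrow> 'a::ab_group_add \<Rightarrow> 'a) \<Rightarrow> ('a \<Rightarrow> 'a) \<Rightarrow> 'a \<Rightarrow> 'f poly \<Rightarrow> 'a"
where
  "poly_action scale S v p = fold_coeffs (\<lambda>a w. scale a v + S w) p 0"

lemma
  assumes "Vector_Spaces.linear scale scale S"
  shows poly_action_0: "poly_action scale S v 0 = 0"
    and poly_action_pCons: "poly_action scale S v (pCons a p) = scale a v + S (poly_action scale S v p)"
    and poly_action_add: "poly_action scale S v (p + q) = poly_action scale S v p + poly_action scale S v q"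
    and poly_action_smult: "poly_action scale S v (smult a p) = scale a (poly_action scale S v p)"
proof -
  interpret Vector_Spaces.linear scale scale S by fact
  show zero: "poly_action scale S v 0 = 0"
    by (simp add: poly_action_def)
  show step: "poly_action scale S v (pCons a p) = scale a v + S (poly_action scale S v p)" for a p
    by (cases "a = 0 \<and> p = 0") (auto simp: poly_action_def)
  show "poly_action scale S v (p + q) = poly_action scale S v p + poly_action scale S v q"
    by (induction p q rule: poly_induct2)
      (simp_all add: zero step add vs1.scale_left_distrib)
  show "poly_action scale S v (smult a p) = scale a (poly_action scale S v p)"
    by (induction p) (simp_all add: zero step scale vs1.scale_right_distrib)
qed

lemma poly_action_monom:
  assumes "Vector_Spaces.linear scale scale S"
  shows "poly_action scale S v (monom a n) = scale a ((S ^^ n) v)"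
proof -
  interpret Vector_Spaces.linear scale scale S by fact
  show ?thesis
    by (induction n)
      (simp_all add: monom_0 monom_Suc poly_action_0 poly_action_pCons linear_axioms scale)
qed

text \<open>Otherwise the vectors \<open>S\<^sup>n v\<close> would be distinct and linearly independent, and there are infinitely
  many of them.\<close>

lemma (in finite_dimensional_vector_space) annihilating_poly_exists:
  assumes S: "Vector_Spaces.linear scale scale S"
  shows "\<exists>p. p \<noteq> 0 \<and> poly_action scale S v p = 0"
proof (rule ccontr)
  assume "\<not> ?thesis"
  then have nonzero: "p = 0" if "poly_action scale S v p = 0" for p
    using that by blast
  define f where "f n = (S ^^ n) v" for n
  have lin: "poly_action scale S v (\<Sum>i\<in>A. monom (u i) i) = (\<Sum>i\<in>A. scale (u i) (f i))"
    if "finite A" for A u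
    using that by (induction A)
      (simp_all add: poly_action_0[OF S] poly_action_add[OF S] poly_action_monom[OF S] f_def)
  have inj: "inj f"
  proof (rule injI)
    fix m n assume "f m = f n"
    then have "poly_action scale S v (monom 1 m + monom (- 1) n) = 0"
      by (simp add: poly_action_add[OF S] poly_action_monom[OF S] f_def)
    then have "monom 1 m = monom (1::'a) n"
      using nonzero[of "monom 1 m + monom (- 1) n"] by (simp add: minus_monom[symmetric])
    then show "m = n"
      by (metis monom_eq_iff' zero_neq_one)
  qed
  have "independent (range f)"
  proof
    assume "dependent (range f)"
    then obtain t u w where t: "finite t" "t \<subseteq> range f" "(\<Sum>x\<in>t. scale (u x) x) = 0"
      and w: "w \<in> t" "u w \<noteq> 0"
      unfolding dependent_explicit by blast
    then obtain A where A: "finite A" "t = f ` A"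
      using inj by (meson finite_subset_image)
    obtain i where i: "i \<in> A" "w = f i" using A w by blast
    have "(\<Sum>i\<in>A. scale (u (f i)) (f i)) = 0"
      using t(3) inj by (simp add: A(2) sum.reindex inj_on_def)
    then have "(\<Sum>i\<in>A. monom (u (f i)) i) = 0"
      using lin[OF A(1), of "\<lambda>i. u (f i)"] nonzero by simp
    then have "coeff (\<Sum>i\<in>A. monom (u (f i)) i) i = 0" by simp
    then show False
      using A(1) i w(2) by (simp add: coeff_sum)
  qed
  then have "finite (range f)" by (rule finiteI_independent)
  with inj show False by (simp add: finite_image_iff)
qed

text \<open>Choose \<open>n\<close> so that the kernel of \<open>N\<^sup>n\<close> is as large as possible. Then \<open>N\<^sup>n\<close> is injective on its own
  range, hence maps it onto itself, and the space is the direct sum of kernel and range.\<close>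

lemma (in finite_dimensional_vector_space) fitting_decomposition:
  assumes N: "Vector_Spaces.linear scale scale N"
  obtains n where "n > 0" "\<And>x. (N ^^ n) ((N ^^ n) x) = 0 \<Longrightarrow> (N ^^ n) x = 0"
    "\<And>x. \<exists>a b. x = a + (N ^^ n) b \<and> (N ^^ n) a = 0"
proof -
  have lin: "Vector_Spaces.linear scale scale (N ^^ n)" for n
  proof (induction n)
    case 0 show ?case by (simp add: Vector_Spaces.linear_iff vector_space_axioms)
  next
    case (Suc n) then show ?case using Vector_Spaces.linear_compose[OF Suc N] by (simp add: comp_def)
  qed
  define K where "K n = {x. (N ^^ n) x = 0}" for n
  have subK: "subspace (K n)" for n
  proof -
    interpret M: Vector_Spaces.linear scale scale "N ^^ n" by (rule lin)
    show ?thesis unfolding K_def by (rule M.subspace_kernel)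
  qed
  have "\<exists>n. n > 0 \<and> (\<forall>m. m > 0 \<longrightarrow> dim (K m) \<le> dim (K n))"
    using ex_has_greatest_nat[of "\<lambda>n. n > 0" 1 "\<lambda>n. dim (K n)" "dimension + 1"]
    by (auto simp: less_Suc_eq_le dim_subset_UNIV)
  then obtain n where n: "n > 0" "\<And>m. m > 0 \<Longrightarrow> dim (K m) \<le> dim (K n)" by blast
  interpret M: Vector_Spaces.linear scale scale "N ^^ n" by (rule lin)
  interpret finite_dimensional_vector_space_pair_1 scale Basis scale by unfold_locales
  have "K n \<subseteq> K (n + n)"
    by (auto simp: K_def funpow_add M.zero)
  then have Keq: "K n = K (n + n)"
    using n by (intro subspace_dim_equal subK) auto
  have ker: "(N ^^ n) x = 0" if "(N ^^ n) ((N ^^ n) x) = 0" for x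
    using that Keq by (auto simp: K_def funpow_add)
  let ?R = "range (N ^^ n)"
  have subR: "subspace ?R" by (intro M.subspace_image) simp
  have inj: "inj_on (N ^^ n) ?R"
  proof (rule inj_onI)
    fix x y assume "x \<in> ?R" "y \<in> ?R" and eq: "(N ^^ n) x = (N ^^ n) y"
    then have "x - y \<in> ?R" using subR by (blast intro: subspace_diff)
    then obtain z where "x - y = (N ^^ n) z" by blast
    then show "x = y" using ker[of z] eq by (metis M.diff diff_self eq_iff_diff_eq_0)
  qed
  have "dim ((N ^^ n) ` ?R) = dim ?R"
    using subR inj by (intro dim_image_eq[OF lin]) (simp add: span_eq_iff[THEN iffD2])
  then have surj: "(N ^^ n) ` ?R = ?R"
    by (intro subspace_dim_equal M.subspace_image subR) auto
  have "\<exists>a b. x = a + (N ^^ n) b \<and> (N ^^ n) a = 0" for x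
  proof -
    have "(N ^^ n) x \<in> (N ^^ n) ` ?R" using surj by blast
    then obtain y where y: "(N ^^ n) x = (N ^^ n) ((N ^^ n) y)" by blast
    show ?thesis
      by (intro exI[of _ "x - (N ^^ n) y"] exI[of _ y]) (simp add: M.diff y)
  qed
  with n ker that show thesis by blast
qed

text \<open>Strip linear factors off a polynomial that annihilates a nonzero vector \<open>v\<close> of the subspace.
  As \<open>v\<close> itself is not zero, some factor \<open>S - c\<close> must kill a nonzero vector of the form \<open>q(S) v\<close>.\<close>

lemma eigenvector_in_invariant_subspace:
  fixes scale :: "'f::alg_closed_field \<Rightarrow> 'a::ab_group_add \<Rightarrow> 'a"
  assumes fd: "finite_dimensional_vector_space scale B"
    and S: "Vector_Spaces.linear scale scale S"
    and V: "module.subspace scale V" "V \<noteq> {0}" "\<And>x. x \<in> V \<Longrightarrow> S x \<in> V"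
  shows "\<exists>c. \<exists>w\<in>V. w \<noteq> 0 \<and> S w = scale c w"
proof -
  interpret finite_dimensional_vector_space scale B by fact
  interpret S: Vector_Spaces.linear scale scale S by fact
  obtain v where v: "v \<in> V" "v \<noteq> 0"
    using V(1,2) subspace_0 by blast
  let ?act = "poly_action scale S v"
  have mem: "?act p \<in> V" for p
    by (induction p)
      (auto simp: poly_action_0[OF S] poly_action_pCons[OF S] v
        intro!: subspace_0 subspace_add subspace_scale V)
  have "\<exists>c. \<exists>w\<in>V. w \<noteq> 0 \<and> S w = scale c w" if "p \<noteq> 0" "?act p = 0" for p
    using that
  proof (induction "degree p" arbitrary: p)
    case 0
    then obtain a where "p = [:a:]" by (metis degree_eq_zeroE)
    with 0 v show ?case
      by (auto simp: poly_action_pCons[OF S] poly_action_0[OF S] S.zero)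
  next
    case (Suc n)
    then obtain c where "poly p c = 0"
      using alg_closed_imp_poly_has_root[of p] by auto
    then obtain q where q: "p = [:- c, 1:] * q" by (auto simp: poly_eq_0_iff_dvd)
    have "p = smult (- c) q + pCons 0 q" by (simp add: q)
    then have "?act p = S (?act q) - scale c (?act q)"
      by (simp only: poly_action_add[OF S] poly_action_smult[OF S] poly_action_pCons[OF S]) simp
    with Suc.prems have *: "S (?act q) = scale c (?act q)" by simp
    have "q \<noteq> 0" using Suc.prems q by auto
    then have "degree q = n" using Suc.hyps(2) unfolding q by (subst (asm) degree_mult_eq) auto
    then show ?case
      using Suc.hyps(1)[of q] \<open>q \<noteq> 0\<close> * mem[of q] by (cases "?act q = 0") auto
  qed
  moreover obtain p where "p \<noteq> 0" "?act p = 0"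
    using annihilating_poly_exists[OF S] by blast
  ultimately show ?thesis by blast
qed

section \<open>The centroid of a Lie algebra\<close>

context lie_algebra
begin

lemma bracket_linear_right: "Vector_Spaces.linear scale scale (bracket x)"
  and bracket_linear_left: "Vector_Spaces.linear scale scale (\<lambda>x. bracket x y)"
  using bracket_bilinear by (simp_all add: bilinear_map_def)

lemma bracket_simps:
  "bracket (x + y) z = bracket x z + bracket y z" "bracket x (y + z) = bracket x y + bracket x z"
  "bracket (scale c x) y = scale c (bracket x y)" "bracket x (scale c y) = scale c (bracket x y)"
  using bracket_linear_left[of z] bracket_linear_left[of y] bracket_linear_right[of x]
  by (simp_all add: Vector_Spaces.linear_iff)

lemma bracket_zero [simp]: "bracket 0 x = 0" "bracket x 0 = 0"
  using bracket_simps(3)[of 0 0 x] bracket_simps(4)[of x 0 0] by simp_all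

lemma bracket_anticommute: "bracket x y = - bracket y x"
proof -
  have "bracket (x + y) (x + y) = bracket x y + bracket y x"
    unfolding bracket_simps(1,2) by (simp add: bracket_self)
  then have "bracket x y + bracket y x = 0" by (simp add: bracket_self)
  then show ?thesis by (simp add: eq_neg_iff_add_eq_0)
qed

lemma bracket_minus: "bracket (- x) y = - bracket x y" "bracket x (- y) = - bracket x y"
  using bracket_simps(3)[of "-1" x y] bracket_simps(4)[of x "-1" y] by simp_all

lemma bracket_diff: "bracket (x - y) z = bracket x z - bracket y z"
  using bracket_simps(1)[of x "- y" z] by (simp add: bracket_minus)

lemma ideal_bracket_right:
  assumes "ideal UNIV A" "x \<in> A"
  shows "bracket x y \<in> A"
  using assms bracket_anticommute[of x y] by (auto simp: ideal_def intro: subspace_neg)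

lemma bracket_in_derived: "x \<in> A \<Longrightarrow> y \<in> A \<Longrightarrow> bracket x y \<in> derived A"
  unfolding derived_def by (intro span_base) blast

lemma subspace_derived: "subspace (derived A)"
  by (simp add: derived_def)

lemma derived_subset_ideal: "ideal UNIV A \<Longrightarrow> derived A \<subseteq> A"
  unfolding derived_def by (intro span_minimal) (auto simp: ideal_def)

definition centroid :: "('a \<Rightarrow> 'a) set" where
  "centroid = {T. Vector_Spaces.linear scale scale T \<and> (\<forall>x y. T (bracket x y) = bracket (T x) y)}"

definition center :: "'a set" where
  "center = {z. \<forall>x. bracket z x = 0}"

lemma centroid_linear: "T \<in> centroid \<Longrightarrow> Vector_Spaces.linear scale scale T"
  by (simp add: centroid_def)

lemma centroid_apply:
  assumes "T \<in> centroid"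
  shows "T (x + y) = T x + T y" "T (scale c x) = scale c (T x)" "T 0 = 0"
    "T (bracket x y) = bracket (T x) y" "T (bracket x y) = bracket x (T y)"
proof -
  interpret T: Vector_Spaces.linear scale scale T using assms by (rule centroid_linear)
  have left: "T (bracket x y) = bracket (T x) y" for x y
    using assms by (simp add: centroid_def)
  show "T (x + y) = T x + T y" "T (scale c x) = scale c (T x)" "T 0 = 0"
    "T (bracket x y) = bracket (T x) y"
    by (simp_all add: T.add T.scale left)
  show "T (bracket x y) = bracket x (T y)"
    using left[of y x] bracket_anticommute[of x y] bracket_anticommute[of x "T y"]
    by (simp add: T.neg)
qed

lemma centroidI:
  assumes "\<And>x y. T (x + y) = T x + T y" "\<And>c x. T (scale c x) = scale c (T x)"
    "\<And>x y. T (bracket x y) = bracket (T x) y"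
  shows "T \<in> centroid"
  using assms vector_space_axioms by (auto simp: centroid_def Vector_Spaces.linear_iff)

lemma centroid_diff_scale: "T \<in> centroid \<Longrightarrow> (\<lambda>x. T x - scale c x) \<in> centroid"
  by (rule centroidI) (simp_all add: centroid_apply(1,2,4) bracket_diff bracket_simps
      scale_right_distrib scale_right_diff_distrib mult.commute algebra_simps)

lemma centroid_comp: "S \<in> centroid \<Longrightarrow> T \<in> centroid \<Longrightarrow> (\<lambda>x. S (T x)) \<in> centroid"
  by (rule centroidI) (simp_all add: centroid_apply(1,2,4))

lemma centroid_funpow: "T \<in> centroid \<Longrightarrow> T ^^ n \<in> centroid"
proof (induction n)
  case 0 show ?case by (rule centroidI) simp_all
next
  case (Suc n) then show ?case using centroid_comp[of T "T ^^ n"] by (simp add: comp_def)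
qed

lemma ideal_centroid_kernel:
  assumes "T \<in> centroid"
  shows "ideal UNIV {x. T x = 0}"
  using assms by (auto simp: ideal_def subspace_def centroid_apply(1,2,3) centroid_apply(5))

lemma ideal_centroid_range:
  assumes "T \<in> centroid"
  shows "ideal UNIV (range T)"
proof -
  interpret T: Vector_Spaces.linear scale scale T using assms by (rule centroid_linear)
  have "bracket x (T y) \<in> range T" for x y
    using centroid_apply(5)[OF assms, of x y] by (metis rangeI)
  then show ?thesis by (auto simp: ideal_def T.subspace_image)
qed

end

lemma (in finite_dimensional_lie_algebra) basis_exists:
  "\<exists>B. finite_dimensional_vector_space scale B"
proof -
  obtain B0 where B0: "finite B0" "span B0 = UNIV" using finite_dimensional by blast
  obtain B where B: "B \<subseteq> B0" "independent B" "B0 \<subseteq> span B"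
    using maximal_independent_subset by blast
  have "finite_dimensional_vector_space scale B"
  proof unfold_locales
    show "finite B" using B(1) B0(1) finite_subset by blast
    show "span B = UNIV" using B0(2) span_mono[OF B(3)] span_span[of B] by blast
  qed (rule B(2))
  then show ?thesis by blast
qed

section \<open>Components of a direct sum of ideals\<close>

locale lie_algebra_direct_sum = lie_algebra scale bracket
  for scale :: "'f::field \<Rightarrow> 'a::ab_group_add \<Rightarrow> 'a" and bracket +
  fixes I :: "'i set" and G :: "'i \<Rightarrow> 'a set"
  assumes direct_sum: "direct_sum_of_ideals I G"
begin

text \<open>Each projection onto a summand belongs to the centroid, so that central and derived
  elements can be studied one summand at a time.\<close>

definition proj :: "'i \<Rightarrow> 'a \<Rightarrow> 'a" where
  "proj j x = (THE f. f \<in> (\<Pi>\<^sub>E j\<in>I. G j) \<and> x = (\<Sum>j\<in>I. f j)) j"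

lemma finite_index: "finite I"
  using direct_sum by (simp add: direct_sum_of_ideals_def)

lemma ideal_G: "j \<in> I \<Longrightarrow> ideal UNIV (G j)"
  using direct_sum by (simp add: direct_sum_of_ideals_def)

lemma subspace_G: "j \<in> I \<Longrightarrow> subspace (G j)"
  using ideal_G by (simp add: ideal_def)

lemma unique_family: "\<exists>!f. f \<in> (\<Pi>\<^sub>E j\<in>I. G j) \<and> x = (\<Sum>j\<in>I. f j)"
  using direct_sum by (simp add: direct_sum_of_ideals_def)

lemma proj_mem: "j \<in> I \<Longrightarrow> proj j x \<in> G j"
  using theI'[OF unique_family[of x]] unfolding proj_def by (auto simp: PiE_iff)

lemma sum_proj: "(\<Sum>j\<in>I. proj j x) = x"
  using theI'[OF unique_family[of x]] unfolding proj_def by simp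

lemma proj_eqI:
  assumes "\<And>j. j \<in> I \<Longrightarrow> f j \<in> G j" "x = (\<Sum>j\<in>I. f j)" "j \<in> I"
  shows "proj j x = f j"
proof -
  have "(THE f. f \<in> (\<Pi>\<^sub>E j\<in>I. G j) \<and> x = (\<Sum>j\<in>I. f j)) = restrict f I"
    using assms(1,2) by (intro the1_equality[OF unique_family]) (auto cong: sum.cong)
  then show ?thesis using assms(3) by (simp add: proj_def)
qed

lemma proj_component:
  assumes "i \<in> I" "j \<in> I" "x \<in> G i"
  shows "proj j x = (if j = i then x else 0)"
  using assms finite_index
  by (intro proj_eqI[where f = "\<lambda>j. if j = i then x else 0"]) (auto simp: subspace_0 subspace_G)

lemma proj_centroid:
  assumes "j \<in> I"
  shows "proj j \<in> centroid"
proof (rule centroidI)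
  fix x y c
  show "proj j (x + y) = proj j x + proj j y"
    by (rule proj_eqI[where f = "\<lambda>j. proj j x + proj j y"])
      (auto simp: assms sum.distrib sum_proj intro: subspace_add subspace_G proj_mem)
  show "proj j (scale c x) = scale c (proj j x)"
    by (rule proj_eqI[where f = "\<lambda>j. scale c (proj j x)"])
      (auto simp: assms sum_proj scale_sum_right[symmetric]
        intro: subspace_scale subspace_G proj_mem)
  interpret B: Vector_Spaces.linear scale scale "\<lambda>x. bracket x y" by (rule bracket_linear_left)
  show "proj j (bracket x y) = bracket (proj j x) y"
    by (rule proj_eqI[where f = "\<lambda>j. bracket (proj j x) y"])
      (auto simp: assms sum_proj B.sum[symmetric] intro: ideal_bracket_right ideal_G proj_mem)
qed

lemmas proj_apply = centroid_apply[OF proj_centroid]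

lemma bracket_component_in_derived:
  assumes "j \<in> I" "x \<in> G j"
  shows "bracket x y \<in> derived (G j)"
proof -
  have "bracket x y = bracket x (proj j y)"
    using proj_apply(4,5)[OF assms(1), of x y] proj_component[OF assms(1,1,2)] by simp
  then show ?thesis using assms proj_mem by (simp add: bracket_in_derived)
qed

lemma centroid_preserves_derived:
  assumes T: "T \<in> centroid" and j: "j \<in> I" and x: "x \<in> derived (G j)"
  shows "T x \<in> derived (G j)"
proof -
  interpret T: Vector_Spaces.linear scale scale T using T by (rule centroid_linear)
  have "T (bracket x y) \<in> derived (G j)" if xy: "x \<in> G j" "y \<in> G j" for x y
  proof -
    have "T (bracket x y) = - bracket y (T x)"
      using centroid_apply(4)[OF T, of x y] bracket_anticommute[of "T x" y] by simp
    then show ?thesis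
      using bracket_component_in_derived[OF j xy(2)] subspace_derived subspace_neg by metis
  qed
  then have "derived (G j) \<subseteq> {x. T x \<in> derived (G j)}"
    unfolding derived_def[of "G j"]
    by (intro span_minimal T.subspace_vimage[unfolded vimage_def])
      (auto simp: derived_def[symmetric] subspace_derived)
  with x show ?thesis by blast
qed

text \<open>A central \<open>z\<close> in \<open>\<gg>\<^sub>j\<close> outside \<open>[\<gg>\<^sub>j,\<gg>\<^sub>j]\<close> would span an ideal, and it would have a complement in \<open>\<gg>\<^sub>j\<close>
  containing \<open>[\<gg>\<^sub>j,\<gg>\<^sub>j]\<close>. Such a complement is itself a nonzero ideal, which contradicts
  indecomposability.\<close>

lemma center_component_in_derived:
  assumes indec: "indecomposable (G j)" and nonab: "derived (G j) \<noteq> {0}"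
    and j: "j \<in> I" and z: "z \<in> center"
  shows "proj j z \<in> derived (G j)"
proof (rule ccontr)
  let ?D = "derived (G j)" and ?z = "proj j z"
  assume notin: "?z \<notin> ?D"
  have zG: "?z \<in> G j" using j by (rule proj_mem)
  have zc: "bracket x ?z = 0" for x
    using z proj_apply(4)[OF j, of z x] proj_apply(3)[OF j] bracket_anticommute[of x ?z]
    by (simp add: center_def)
  obtain B0 where B0: "B0 \<subseteq> ?D" "independent B0" "?D \<subseteq> span B0"
    using maximal_independent_subset by blast
  have "span B0 \<subseteq> ?D" using B0(1) subspace_derived by (rule span_minimal)
  then have "independent (insert ?z B0)" using notin B0(2) by (intro independent_insertI) auto
  moreover have DG: "?D \<subseteq> G j" using derived_subset_ideal ideal_G j by blast
  ultimately obtain B where B: "insert ?z B0 \<subseteq> B" "B \<subseteq> G j" "independent B" "G j \<subseteq> span B"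
    using maximal_independent_subset_extend[of "insert ?z B0" "G j"] B0(1) zG
    by (metis insert_subset order_trans)
  \<comment> \<open>the complement of the central line, containing the derived algebra\<close>
  let ?H = "span (B - {?z})"
  have spanB: "span B = G j" using B(2,4) subspace_G[OF j] by (simp add: span_minimal subset_antisym)
  have HG: "?H \<subseteq> G j" using spanB span_mono[of "B - {?z}" B] by auto
  have zH: "?z \<notin> ?H" using B(1,3) by (auto simp: dependent_def)
  have "B0 \<subseteq> B - {?z}" using B(1) notin B0(1) by auto
  then have DH: "?D \<subseteq> ?H" using B0(3) span_mono by blast
  have "ideal (G j) ?H"
    using HG DH by (auto simp: ideal_def intro: bracket_in_derived[THEN subsetD[OF DH]])
  moreover have "ideal (G j) (span {?z})"
    unfolding ideal_def
    using zG subspace_G[OF j]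
    by (auto simp: span_singleton[of ?z] bracket_simps zc intro: subspace_scale)
      (metis span_singleton subspace_span)
  moreover have "?H \<noteq> {0}" using DH nonab subspace_0[OF subspace_derived] by blast
  moreover have "?z \<noteq> 0" using notin subspace_0[OF subspace_derived] by metis
  then have "span {?z} \<noteq> {0}" using span_base[of ?z "{?z}"] by auto
  moreover have "span {?z} + ?H = G j"
  proof -
    have "insert ?z (B - {?z}) = B" using B(1) by auto
    then have mem: "x \<in> G j \<longleftrightarrow> (\<exists>k. x - scale k ?z \<in> ?H)" for x
      using span_breakdown_eq[of x ?z "B - {?z}"] spanB by simp
    show ?thesis
    proof (intro set_eqI iffI)
      fix x assume "x \<in> span {?z} + ?H"
      then obtain k h where "h \<in> ?H" "x = scale k ?z + h"
        by (auto simp: set_plus_def span_singleton[of ?z])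
      then have "x - scale k ?z \<in> ?H" by simp
      then show "x \<in> G j" using mem by blast
    next
      fix x assume "x \<in> G j"
      then obtain k where "x - scale k ?z \<in> ?H" using mem by blast
      then have "scale k ?z + (x - scale k ?z) \<in> span {?z} + ?H"
        by (intro set_plus_intro) (auto simp: span_singleton[of ?z])
      then show "x \<in> span {?z} + ?H" by simp
    qed
  qed
  moreover have "span {?z} \<inter> ?H = {0}"
  proof -
    have "c = 0" if "scale c ?z \<in> ?H" for c
      using that zH span_scale[of "scale c ?z" "B - {?z}" "inverse c"] by (cases "c = 0") auto
    then show ?thesis by (auto simp: span_singleton[of ?z] span_zero)
  qed
  ultimately show False using indec unfolding indecomposable_def by blast
qed

end

text \<open>The centroid of an indecomposable Lie algebra is a local ring. The argument applies Fitting's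
  lemma to the component of \<open>T - c\<close> that maps \<open>\<gg>\<^sub>j\<close> to itself, where \<open>c\<close> is an eigenvalue of the
  corresponding component of \<open>T\<close>: kernel and range of a power are complementary ideals of \<open>\<gg>\<^sub>j\<close>, and
  the kernel is not zero. Although \<open>T\<close> may move \<open>\<gg>\<^sub>j\<close> into other summands, it preserves the
  derived algebra of \<open>\<gg>\<^sub>j\<close>, which is why the conclusion about \<open>T\<close> itself is made there.\<close>

lemma nilpotent_part_of_centroid_on_derived:
  fixes scale :: "'f::alg_closed_field \<Rightarrow> 'a::ab_group_add \<Rightarrow> 'a"
  assumes "finite_dimensional_lie_algebra scale bracket" "lie_algebra_direct_sum scale bracket I G"
    and indec: "lie_algebra.indecomposable scale bracket (G j)" and "G j \<noteq> {0}"
    and j: "j \<in> I" and T: "T \<in> lie_algebra.centroid scale bracket"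
  shows "\<exists>c n. n > 0 \<and>
    (\<forall>x\<in>lie_algebra.derived scale bracket (G j). ((\<lambda>x. T x - scale c x) ^^ n) x = 0)"
proof -
  interpret finite_dimensional_lie_algebra scale bracket by fact
  interpret lie_algebra_direct_sum scale bracket I G by fact
  obtain B where fd: "finite_dimensional_vector_space scale B"
    using basis_exists by blast
  let ?P = "proj j"
  have PT: "(\<lambda>x. ?P (T x)) \<in> centroid" using proj_centroid[OF j] T by (rule centroid_comp)
  have "\<exists>c. \<exists>w\<in>G j. w \<noteq> 0 \<and> ?P (T w) = scale c w"
    by (rule eigenvector_in_invariant_subspace[OF fd centroid_linear[OF PT] subspace_G[OF j] \<open>G j \<noteq> {0}\<close>
          proj_mem[OF j]])
  then obtain c w where w: "w \<in> G j" "w \<noteq> 0" "?P (T w) = scale c w" by blast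
  \<comment> \<open>extended by zero to the other summands, so that it lies in the centroid of the whole algebra\<close>
  define N where "N = (\<lambda>x. ?P (T (?P x) - scale c (?P x)))"
  have N: "N \<in> centroid"
    unfolding N_def
    using centroid_comp[OF proj_centroid[OF j]
        centroid_comp[OF centroid_diff_scale[OF T] proj_centroid[OF j]]] .
  obtain n where n: "n > 0" "\<And>x. (N ^^ n) ((N ^^ n) x) = 0 \<Longrightarrow> (N ^^ n) x = 0"
    "\<And>x. \<exists>a b. x = a + (N ^^ n) b \<and> (N ^^ n) a = 0"
    using finite_dimensional_vector_space.fitting_decomposition[OF fd centroid_linear[OF N]] by metis
  have Nn: "N ^^ n \<in> centroid" using N by (rule centroid_funpow)
  let ?K = "{x. (N ^^ n) x = 0}" and ?R = "range (N ^^ n)"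
  have RG: "?R \<subseteq> G j"
    using n(1) proj_mem[OF j] by (cases n) (auto simp: N_def)
  have "?P w = w" using proj_component[OF j j w(1)] by simp
  then have "N w = 0"
    using w(3) proj_apply(1)[OF j, of "T w - scale c w" "scale c w"] proj_apply(2)[OF j, of c w]
    by (simp add: N_def)
  then have "(N ^^ n) w = 0"
    using n(1) centroid_apply(3)[OF centroid_funpow[OF N]] by (cases n) (auto simp: funpow_swap1)
  then have wK: "w \<in> G j \<inter> ?K" using w by simp
  have "ideal (G j) (G j \<inter> ?K)"
    using ideal_G[OF j] ideal_centroid_kernel[OF Nn] by (auto simp: ideal_def subspace_inter)
  moreover have "ideal (G j) ?R"
    using ideal_centroid_range[OF Nn] RG by (auto simp: ideal_def)
  moreover have "(G j \<inter> ?K) + ?R = G j"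
  proof
    show "(G j \<inter> ?K) + ?R \<subseteq> G j"
      using RG subspace_add[OF subspace_G[OF j]] by (auto simp: set_plus_def)
    show "G j \<subseteq> (G j \<inter> ?K) + ?R"
    proof
      fix x assume x: "x \<in> G j"
      obtain a b where ab: "x = a + (N ^^ n) b" "(N ^^ n) a = 0" using n(3) by blast
      have "a = x - (N ^^ n) b" using ab by simp
      then have "a \<in> G j" using x RG subspace_diff[OF subspace_G[OF j]] by blast
      with ab show "x \<in> (G j \<inter> ?K) + ?R" by (auto simp: set_plus_def)
    qed
  qed
  moreover have "(G j \<inter> ?K) \<inter> ?R = {0}"
    using n(2) subspace_0[OF subspace_G[OF j]] centroid_apply(3)[OF Nn]
    by auto
  ultimately have "?R = {0}"
    using indec wK w(2) unfolding indecomposable_def by blast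
  then have zero: "(N ^^ n) x = 0" for x by blast
  have step: "N x = T x - scale c x" if "x \<in> derived (G j)" for x
  proof -
    have mem: "x \<in> G j" "T x - scale c x \<in> G j"
      using that derived_subset_ideal[OF ideal_G[OF j]]
        centroid_preserves_derived[OF centroid_diff_scale[OF T] j that] by auto
    then show ?thesis by (simp add: N_def proj_component[OF j j])
  qed
  have "((\<lambda>x. T x - scale c x) ^^ m) x = (N ^^ m) x \<and> (N ^^ m) x \<in> derived (G j)"
    if "x \<in> derived (G j)" for m x
    using that
  proof (induction m)
    case (Suc m)
    then show ?case
      using step[of "(N ^^ m) x"] centroid_preserves_derived[OF N j, of "(N ^^ m) x"] by simp
  qed simp
  with zero n(1) show ?thesis by (intro exI[of _ c] exI[of _ n]) simp
qed


section \<open>Hermitian metrics that detect a block structure\<close>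

locale nonabelian_decomposition =
  finite_dimensional_lie_algebra scale bracket + lie_algebra_direct_sum scale bracket I G
  for scale :: "complex \<Rightarrow> 'a::ab_group_add \<Rightarrow> 'a" and bracket
    and I :: "'i set" and G :: "'i \<Rightarrow> 'a set" +
  assumes indecomposable_G: "j \<in> I \<Longrightarrow> indecomposable (G j)"
    and nonabelian_G: "j \<in> I \<Longrightarrow> derived (G j) \<noteq> {0}"
begin

lemma derived_subset_G: "j \<in> I \<Longrightarrow> derived (G j) \<subseteq> G j"
  using derived_subset_ideal ideal_G by blast

lemma nonzero_in_derived:
  assumes "j \<in> I"
  obtains u where "u \<in> derived (G j)" "u \<noteq> 0"
  using nonabelian_G[OF assms] subspace_0[OF subspace_derived] by blast

lemma G_nonzero: "j \<in> I \<Longrightarrow> G j \<noteq> {0}"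
  using derived_subset_G nonzero_in_derived by (metis singletonD subsetD)

end

text \<open>Here \<open>ip\<close> is the real part of a Hermitian form. The last two conditions encode the block
  structure: orthogonality lets the sign of a structure be chosen block by block, and the link
  between derived algebras prevents a finer choice.\<close>

locale block_metric =
  nonabelian_decomposition scale bracket I G
  for scale :: "complex \<Rightarrow> 'a::ab_group_add \<Rightarrow> 'a" and bracket
    and I :: "'i set" and G :: "'i \<Rightarrow> 'a set" +
  fixes ip :: "'a \<Rightarrow> 'a \<Rightarrow> real" and block :: "'i \<Rightarrow> 'm"
  assumes inner_product: "inner_product (restrict_scalars scale) ip"
    and hermitian: "ip (scale \<i> x) (scale \<i> y) = ip x y"
    and blocks_orthogonal:
      "i \<in> I \<Longrightarrow> j \<in> I \<Longrightarrow> block i \<noteq> block j \<Longrightarrow> x \<in> G i \<Longrightarrow> y \<in> G j \<Longrightarrow> ip x y = 0"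
    and blocks_linked:
      "i \<in> I \<Longrightarrow> j \<in> I \<Longrightarrow> i \<noteq> j \<Longrightarrow> block i = block j \<Longrightarrow>
        \<exists>x\<in>derived (G i). \<exists>y\<in>derived (G j). ip x y \<noteq> 0"
begin

lemma ip_commute: "ip x y = ip y x"
  and ip_pos: "x \<noteq> 0 \<Longrightarrow> ip x x > 0"
  and ip_add_left: "ip (x + y) z = ip x z + ip y z"
  and ip_real_left: "ip (scale (of_real r) x) y = r * ip x y"
  using inner_product
  by (simp_all add: inner_product_def bilinear_map_def restrict_scalars_def Vector_Spaces.linear_iff)

lemma ip_add_right: "ip z (x + y) = ip z x + ip z y"
  and ip_real_right: "ip y (scale (of_real r) x) = r * ip y x"
  by (metis ip_commute ip_add_left, metis ip_commute ip_real_left)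

lemma ip_zero [simp]: "ip 0 x = 0" "ip x 0 = 0"
  using ip_real_left[of 0 0 x] ip_real_right[of x 0 0] by simp_all

lemma ip_minus_left: "ip (- x) y = - ip x y"
  using ip_add_left[of x "- x" y] by simp

lemma ip_minus_right: "ip y (- x) = - ip y x"
  by (metis ip_commute ip_minus_left)

lemma ip_diff_left: "ip (x - y) z = ip x z - ip y z"
  using ip_add_left[of x "- y" z] by (simp add: ip_minus_left)

lemma ip_diff_right: "ip z (x - y) = ip z x - ip z y"
  by (metis ip_commute ip_diff_left)

lemma ip_sum_left: "ip (\<Sum>a\<in>A. f a) y = (\<Sum>a\<in>A. ip (f a) y)"
  by (induction A rule: infinite_finite_induct) (simp_all add: ip_add_left)

lemma ip_sum_right: "ip y (\<Sum>a\<in>A. f a) = (\<Sum>a\<in>A. ip y (f a))"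
  by (induction A rule: infinite_finite_induct) (simp_all add: ip_add_right)

lemma ip_eq_0_iff: "ip x x = 0 \<longleftrightarrow> x = 0"
  by (metis ip_pos ip_zero(1) less_irrefl)

lemma scale_i_i [simp]: "scale \<i> (scale \<i> x) = - x"
  by simp

lemma ip_i_left: "ip (scale \<i> x) y = - ip x (scale \<i> y)"
  using hermitian[of x "scale \<i> y"] by (simp add: ip_minus_right)

lemma ip_i_self [simp]: "ip (scale \<i> x) x = 0"
  using ip_i_left[of x x] ip_commute[of x "scale \<i> x"] by simp

lemma scale_Re_Im: "scale c x = scale (of_real (Re c)) x + scale (of_real (Im c)) (scale \<i> x)"
  by (metis complex_eq mult.commute scale_left_distrib scale_scale)

lemma ip_complex_left: "ip (scale c x) y = Re c * ip x y + Im c * ip (scale \<i> x) y"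
  by (subst scale_Re_Im) (simp only: ip_add_left ip_real_left)

text \<open>For symmetric \<open>N\<close>, \<open>\<bar>N\<^sup>n x\<bar>\<^sup>2 = \<langle>N\<^sup>n\<^sup>-\<^sup>1 x, N\<^sup>n\<^sup>+\<^sup>1 x\<rangle>\<close>, so the exponent in \<open>N\<^sup>n\<^sup>+\<^sup>1 x = 0\<close> can be lowered.\<close>

lemma symmetric_nilpotent_vanishes:
  assumes sym: "\<And>x y. ip (N x) y = ip x (N y)" and "(N ^^ n) x = 0" "n > 0" and N0: "N 0 = 0"
  shows "N x = 0"
  using assms(2,3)
proof (induction n)
  case (Suc n)
  show ?case
  proof (cases n)
    case 0
    with Suc.prems show ?thesis by simp
  next
    case (Suc m)
    have "ip ((N ^^ n) x) ((N ^^ n) x) = ip ((N ^^ m) x) ((N ^^ Suc n) x)"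
      using sym[of "(N ^^ m) x" "(N ^^ n) x"] by (simp add: Suc)
    then have "(N ^^ n) x = 0" using Suc.prems by (simp add: ip_eq_0_iff)
    with Suc.IH Suc show ?thesis by simp
  qed
qed simp

text \<open>The scalar part of \<open>T\<close> is an eigenvalue on the derived algebra, hence real by symmetry; the
  nilpotent part is then symmetric as well and vanishes.\<close>

lemma symmetric_centroid_scalar_on_derived:
  assumes T: "T \<in> centroid" and sym: "\<And>x y. ip (T x) y = ip x (T y)" and j: "j \<in> I"
  shows "\<exists>r. \<forall>x\<in>derived (G j). T x = scale (of_real r) x"
proof -
  obtain c n where n: "n > 0"
    and nil: "\<And>x. x \<in> derived (G j) \<Longrightarrow> ((\<lambda>x. T x - scale c x) ^^ n) x = 0"
    using nilpotent_part_of_centroid_on_derived[OF finite_dimensional_lie_algebra_axioms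
        lie_algebra_direct_sum_axioms indecomposable_G[OF j] G_nonzero[OF j] j T]
    by blast
  define N where "N = (\<lambda>x. T x - scale c x)"
  have nil: "(N ^^ n) x = 0" if "x \<in> derived (G j)" for x
    unfolding N_def using nil[OF that] .
  have N: "N \<in> centroid" unfolding N_def by (rule centroid_diff_scale[OF T])
  \<comment> \<open>the last nonzero vector among the iterates \<open>N\<^sup>p u\<close> is an eigenvector of \<open>T\<close>\<close>
  obtain u where u: "u \<in> derived (G j)" "u \<noteq> 0" using j by (rule nonzero_in_derived)
  define m where "m = (LEAST m. (N ^^ m) u = 0)"
  have m: "(N ^^ m) u = 0"
    unfolding m_def using nil[OF u(1)] by (rule LeastI)
  then obtain p where p: "m = Suc p" using u(2) by (cases m) auto
  define v where "v = (N ^^ p) u"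
  have v: "v \<noteq> 0" using not_less_Least[of p "\<lambda>m. (N ^^ m) u = 0"] p by (simp add: m_def v_def)
  have "T v = scale c v" using m by (simp add: p v_def N_def)
  then have "ip (scale c v) (scale \<i> v) = ip v (scale c (scale \<i> v))"
    using sym[of v "scale \<i> v"] by (simp add: centroid_apply(2)[OF T] mult.commute)
  then have "Im c * ip v v = 0"
    by (simp only: ip_complex_left[of c] ip_commute[of v "scale c _"] hermitian scale_i_i
        ip_minus_left ip_i_self ip_commute[of v "scale \<i> v"])
  then have c: "c = of_real (Re c)" using v by (simp add: ip_eq_0_iff complex_eq_iff)
  have Nsym: "ip (N x) y = ip x (N y)" for x y
    unfolding N_def
    by (subst (1 2) c) (simp only: ip_diff_left ip_diff_right ip_real_left ip_real_right sym)
  have "N x = 0" if "x \<in> derived (G j)" for x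
    using symmetric_nilpotent_vanishes[OF Nsym nil[OF that] n] centroid_apply(3)[OF N] by blast
  then show ?thesis using c by (auto simp: N_def intro!: exI[of _ "Re c"])
qed

text \<open>The error \<open>w\<close> of the scalar approximation is central, and its components lie in derived
  algebras, on which \<open>T\<close> is already known. Moving \<open>T\<close> across the inner product shows that \<open>w\<close> is
  orthogonal to each of its components: inside the block the scalars agree, and outside it
  the blocks are orthogonal.\<close>

lemma symmetric_centroid_scalar_on_blocks:
  assumes T: "T \<in> centroid" and sym: "\<And>x y. ip (T x) y = ip x (T y)"
  shows "\<exists>t. \<forall>j\<in>I. \<forall>x\<in>G j. T x = scale (of_real (t (block j))) x"
proof -
  obtain r where r: "\<And>j x. j \<in> I \<Longrightarrow> x \<in> derived (G j) \<Longrightarrow> T x = scale (of_real (r j)) x"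
    using symmetric_centroid_scalar_on_derived[OF T sym] by metis
  have same: "r i = r j" if ij: "i \<in> I" "j \<in> I" "block i = block j" for i j
  proof (cases "i = j")
    case False
    then obtain x y where xy: "x \<in> derived (G i)" "y \<in> derived (G j)" "ip x y \<noteq> 0"
      using blocks_linked ij by blast
    have "r i * ip x y = r j * ip x y"
      using sym[of x y] r ij xy(1,2) by (simp add: ip_real_left ip_real_right)
    with xy(3) show ?thesis by simp
  qed simp
  define t where "t m = r (SOME j. j \<in> I \<and> block j = m)" for m
  have t: "t (block j) = r j" if "j \<in> I" for j
    unfolding t_def by (rule same) (use that someI[of "\<lambda>i. i \<in> I \<and> block i = block j" j] in auto)
  have "T x = scale (of_real (t (block j))) x" if j: "j \<in> I" and x: "x \<in> G j" for j x
  proof -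
    define w where "w = T x - scale (of_real (r j)) x"
    have "bracket w y = 0" for y
      using r[OF j bracket_component_in_derived[OF j x, of y]]
      by (simp add: w_def bracket_diff bracket_simps centroid_apply(4)[OF T, symmetric])
    then have w: "w \<in> center" by (simp add: center_def)
    have "ip w (proj i w) = 0" if i: "i \<in> I" for i
    proof -
      let ?z = "proj i w"
      have z: "?z \<in> derived (G i)"
        using indecomposable_G[OF i] nonabelian_G[OF i] i w by (rule center_component_in_derived)
      have "ip w ?z = ip x (T ?z) - r j * ip x ?z"
        by (simp add: w_def ip_diff_left ip_real_left sym)
      also have "\<dots> = (r i - r j) * ip x ?z"
        by (simp only: r[OF i z] ip_real_right) (simp add: algebra_simps)
      also have "\<dots> = 0"
        using same[OF i j] blocks_orthogonal[OF j i _ x proj_mem[OF i, of w]]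
        by (cases "block i = block j") auto
      finally show ?thesis .
    qed
    then have "ip w (\<Sum>i\<in>I. proj i w) = 0" by (simp add: ip_sum_right)
    then have "w = 0" by (simp add: sum_proj ip_eq_0_iff)
    then show ?thesis by (simp add: w_def t j)
  qed
  then show ?thesis by blast
qed

section \<open>The orthogonal bi-invariant complex structures\<close>

abbreviation structures :: "('a \<Rightarrow> 'a) set" where
  "structures \<equiv>
    {J. orthogonal_biinvariant_complex_structure (restrict_scalars scale) bracket ip J}"

definition sign_structure :: "'m set \<Rightarrow> 'a \<Rightarrow> 'a" where
  "sign_structure A x = scale \<i> (\<Sum>j\<in>I. scale (if block j \<in> A then 1 else - 1) (proj j x))"

lemma sign_structure_component:
  assumes "j \<in> I" "x \<in> G j"
  shows "sign_structure A x = scale (if block j \<in> A then \<i> else - \<i>) x"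
proof -
  have "(\<Sum>i\<in>I. scale (if block i \<in> A then 1 else - 1) (proj i x)) =
      (\<Sum>i\<in>I. if i = j then scale (if block j \<in> A then 1 else - 1) x else 0)"
    using assms by (intro sum.cong) (auto simp: proj_component)
  then show ?thesis using assms(1) finite_index by (simp add: sign_structure_def)
qed

lemma proj_sign_structure:
  assumes "j \<in> I"
  shows "proj j (sign_structure A x) = scale (if block j \<in> A then \<i> else - \<i>) (proj j x)"
proof (rule proj_eqI[where f = "\<lambda>j. scale (if block j \<in> A then \<i> else - \<i>) (proj j x)"])
  show "scale (if block j \<in> A then \<i> else - \<i>) (proj j x) \<in> G j" if "j \<in> I" for j
    using subspace_G[OF that] proj_mem[OF that] by (rule subspace_scale)
  show "j \<in> I" by (rule assms)
qed (auto simp: sign_structure_def scale_sum_right intro!: sum.cong)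

text \<open>In the expansion of \<open>\<langle>J x, J y\<rangle>\<close> into components the signs agree inside a block, while the terms
  that belong to different blocks vanish.\<close>

lemma sign_structure_in_structures: "sign_structure A \<in> structures"
proof -
  let ?s = "\<lambda>j. if block j \<in> A then 1 else - 1 :: complex"
  have eqI: "x = y" if "\<And>j. j \<in> I \<Longrightarrow> proj j x = proj j y" for x y
    using that sum_proj[of x] sum_proj[of y] by (metis sum.cong)
  have cen: "sign_structure A \<in> centroid"
    by (rule centroidI; rule eqI) (simp_all add: proj_sign_structure proj_apply(1,2,4)
        scale_right_distrib bracket_simps bracket_minus mult.commute)
  have sq: "sign_structure A (sign_structure A x) = - x" for x
  proof (rule eqI)
    fix j assume j: "j \<in> I"
    interpret P: Vector_Spaces.linear scale scale "proj j" by (rule centroid_linear[OF proj_centroid[OF j]])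
    show "proj j (sign_structure A (sign_structure A x)) = proj j (- x)"
      using j by (simp add: proj_sign_structure P.neg)
  qed
  have orth: "ip (sign_structure A x) (sign_structure A y) = ip x y" for x y
  proof -
    have "ip (sign_structure A x) (sign_structure A y) =
        (\<Sum>i\<in>I. \<Sum>j\<in>I. ip (scale (?s i) (proj i x)) (scale (?s j) (proj j y)))"
      by (simp only: sign_structure_def hermitian ip_sum_left) (simp only: ip_sum_right)
    also have "\<dots> = (\<Sum>i\<in>I. \<Sum>j\<in>I. ip (proj i x) (proj j y))"
    proof (intro sum.cong refl)
      fix i j assume ij: "i \<in> I" "j \<in> I"
      show "ip (scale (?s i) (proj i x)) (scale (?s j) (proj j y)) = ip (proj i x) (proj j y)"
        using blocks_orthogonal[OF ij _ proj_mem[OF ij(1)] proj_mem[OF ij(2)]]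
        by (cases "block i = block j") (auto simp: ip_minus_left ip_minus_right)
    qed
    also have "\<dots> = ip (\<Sum>i\<in>I. proj i x) (\<Sum>j\<in>I. proj j y)"
      by (simp only: ip_sum_left) (simp only: ip_sum_right)
    finally show ?thesis by (simp only: sum_proj)
  qed
  show ?thesis
    using linear_restrict_scalars[OF centroid_linear[OF cen]] sq centroid_apply(4)[OF cen] orth
    by (simp add: orthogonal_biinvariant_complex_structure_def)
qed

text \<open>The operator \<open>T = J \<i> + \<i> J\<close> is a symmetric element of the centroid, hence a real scalar \<open>t\<close> on each
  block. It measures the angle between \<open>J x\<close> and \<open>\<i> x\<close>, and \<open>t = \<plusminus>2\<close> means that they are parallel.\<close>

lemma structure_eq_sign_structure:
  assumes "J \<in> structures"
  shows "\<exists>A \<subseteq> block ` I. J = sign_structure A"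
proof -
  have J: "Vector_Spaces.linear (restrict_scalars scale) (restrict_scalars scale) J"
    and sq: "\<And>x. J (J x) = - x" and Jleft: "\<And>x y. J (bracket x y) = bracket (J x) y"
    and orth: "\<And>x y. ip (J x) (J y) = ip x y"
    using assms by (simp_all add: orthogonal_biinvariant_complex_structure_def)
  have Jadd: "J (x + y) = J x + J y" and Jreal: "J (scale (of_real r) x) = scale (of_real r) (J x)"
    for x y r
    using J by (simp_all add: Vector_Spaces.linear_iff restrict_scalars_def)
  have J0: "J 0 = 0" using Jreal[of 0 0] by simp
  have Jminus: "J (- x) = - J x" for x using Jreal[of "- 1" x] by simp
  have Jright: "J (bracket x y) = bracket x (J y)" for x y
    by (metis Jleft Jminus bracket_anticommute)
  have Jscale: "J (scale c x) = scale (of_real (Re c)) (J x) + scale (of_real (Im c)) (J (scale \<i> x))"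
    for c x by (subst scale_Re_Im) (simp only: Jadd Jreal)
  define T where "T = (\<lambda>x. J (scale \<i> x) + scale \<i> (J x))"
  have T: "T \<in> centroid"
  proof (rule centroidI)
    fix x y c
    show "T (x + y) = T x + T y" by (simp add: T_def Jadd scale_right_distrib)
    show "T (bracket x y) = bracket (T x) y"
      by (simp add: T_def bracket_simps Jleft flip: bracket_simps(3))
    have Ti: "T (scale \<i> x) = scale \<i> (T x)" for x
      by (simp add: T_def Jminus scale_right_distrib)
    have Tr: "T (scale (of_real r) x) = scale (of_real r) (T x)" for r x
      using Jreal[of r "scale \<i> x"] by (simp add: T_def Jreal scale_right_distrib mult.commute)
    have Ta: "T (x + y) = T x + T y" for x y by (simp add: T_def Jadd scale_right_distrib)
    show "T (scale c x) = scale c (T x)"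
      by (subst (1 2) scale_Re_Im) (simp only: Ta Tr Ti)
  qed
  have Jskew: "ip (J x) y = - ip x (J y)" for x y
    using orth[of x "J y"] by (simp add: sq ip_minus_right)
  have sym: "ip (T x) y = ip x (T y)" for x y
    by (simp add: T_def ip_add_left ip_add_right Jskew ip_i_left)
  obtain t where t: "\<And>j x. j \<in> I \<Longrightarrow> x \<in> G j \<Longrightarrow> T x = scale (of_real (t (block j))) x"
    using symmetric_centroid_scalar_on_blocks[OF T sym] by blast
  \<comment> \<open>on brackets, \<open>J\<close> and \<open>\<i>\<close> can be moved to different arguments, so they commute there\<close>
  have comm: "J (scale \<i> u) = scale \<i> (J u)" if "u \<in> derived A" for u A
  proof -
    have "subspace {u. J (scale \<i> u) = scale \<i> (J u)}"
    proof (rule subspaceI)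
      fix c x assume "x \<in> {u. J (scale \<i> u) = scale \<i> (J u)}"
      then have x: "J (scale \<i> x) = scale \<i> (J x)" by simp
      have "J (scale c x) = scale c (J x)" "J (scale (\<i> * c) x) = scale (\<i> * c) (J x)"
        using scale_Re_Im[of c "J x"] scale_Re_Im[of "\<i> * c" "J x"]
        by (simp_all only: Jscale[of c x] Jscale[of "\<i> * c" x] x)
      then show "scale c x \<in> {u. J (scale \<i> u) = scale \<i> (J u)}" by simp
    qed (simp_all add: J0 Jadd scale_right_distrib)
    moreover have "J (scale \<i> (bracket x y)) = scale \<i> (J (bracket x y))" for x y
      using Jright[of "scale \<i> x" y] Jright[of x y] by (simp add: bracket_simps)
    ultimately have "derived A \<subseteq> {u. J (scale \<i> u) = scale \<i> (J u)}"
      unfolding derived_def by (intro span_minimal) auto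
    with that show ?thesis by blast
  qed
  \<comment> \<open>on derived vectors \<open>T = 2 \<i> J\<close> and \<open>(\<i> J)\<^sup>2 = 1\<close>\<close>
  have t2: "t (block j) ^ 2 = 4" if j: "j \<in> I" for j
  proof -
    obtain u where u: "u \<in> derived (G j)" "u \<noteq> 0" using j by (rule nonzero_in_derived)
    let ?t = "complex_of_real (t (block j))"
    have tu: "scale ?t u = scale 2 (J (scale \<i> u))"
    proof -
      have "scale ?t u = T u" using t[OF j] u(1) derived_subset_G[OF j] by auto
      also have "\<dots> = J (scale \<i> u) + J (scale \<i> u)" using comm[OF u(1)] by (simp add: T_def)
      finally show ?thesis by (metis one_add_one scale_left_distrib scale_one)
    qed
    have "scale ?t (J u) = J (scale ?t u)" by (simp add: Jreal)
    also have "\<dots> = scale 2 (J (J (scale \<i> u)))"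
      using Jreal[of 2] by (simp add: tu)
    finally have tJ: "scale ?t (J u) = - scale 2 (scale \<i> u)" by (simp add: sq)
    have "scale (?t * ?t) u = scale 2 (scale \<i> (scale ?t (J u)))"
      using comm[OF u(1)] tu by (metis mult.commute scale_scale)
    also have "\<dots> = scale 4 u" by (simp add: tJ scale_minus_right)
    finally have "?t * ?t = 4" using u(2) by (simp add: scale_cancel_right)
    then show ?thesis
      by (metis of_real_eq_iff of_real_mult of_real_numeral power2_eq_square)
  qed
  have Jj: "J x = scale (of_real (- t (block j) / 2)) (scale \<i> x)"
    if j: "j \<in> I" and x: "x \<in> G j" for j x
  proof -
    define s where "s = t (block j) / 2"
    have s2: "s * s = 1" using t2[OF j] by (simp add: s_def power2_eq_square)
    have "2 * s * ip x x = ip (T x) x" using t[OF j x] by (simp add: ip_real_left s_def)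
    also have "\<dots> = - 2 * ip (J x) (scale \<i> x)"
      unfolding T_def ip_add_left Jskew[of "scale \<i> x"] ip_i_left[of "J x"]
        ip_commute[of "scale \<i> x" "J x"] by simp
    finally have 1: "ip (J x) (scale \<i> x) = - s * ip x x" by simp
    \<comment> \<open>the squared norm of this vector is \<open>1 - s\<^sup>2 = 0\<close> times that of \<open>x\<close>\<close>
    let ?w = "J x + scale (of_real s) (scale \<i> x)"
    have "ip ?w ?w = ip x x + s * ip (J x) (scale \<i> x) + s * ip (J x) (scale \<i> x) + s * s * ip x x"
      by (simp only: ip_add_left ip_add_right ip_real_left ip_real_right orth hermitian
          ip_commute[of "scale \<i> x" "J x"]) (simp add: algebra_simps)
    also have "\<dots> = (1 - s * s) * ip x x" by (simp only: 1) (simp add: algebra_simps)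
    finally have "?w = 0" using s2 by (simp add: ip_eq_0_iff)
    then have "J x = - scale (of_real s) (scale \<i> x)" by (simp add: eq_neg_iff_add_eq_0)
    then show ?thesis by (simp add: s_def)
  qed
  \<comment> \<open>\<open>J = - t/2 \<i>\<close>, so the blocks with sign \<open>+\<close> are those with \<open>t = - 2\<close>\<close>
  define A where "A = {m \<in> block ` I. t m = - 2}"
  have "J x = sign_structure A x" for x
  proof -
    have comp: "J y = sign_structure A y" if j: "j \<in> I" and y: "y \<in> G j" for j y
    proof -
      have "t (block j) = 2 \<or> t (block j) = - 2"
        using t2[OF j] power2_eq_iff[of "t (block j)" 2] by simp
      then show ?thesis
        using Jj[OF j y] j by (auto simp: sign_structure_component[OF j y] A_def)
    qed
    have sums: "J (sum f B) = (\<Sum>b\<in>B. J (f b))" for f :: "'i \<Rightarrow> 'a" and B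
      by (induction B rule: infinite_finite_induct) (simp_all add: J0 Jadd)
    have "J x = (\<Sum>j\<in>I. J (proj j x))" by (metis sums sum_proj)
    also have "\<dots> = (\<Sum>j\<in>I. proj j (sign_structure A x))"
      by (intro sum.cong) (auto simp: comp proj_mem sign_structure_component proj_sign_structure)
    finally show ?thesis by (simp only: sum_proj)
  qed
  then show ?thesis by (intro exI[of _ A]) (auto simp: A_def)
qed

lemma card_structures: "card structures = 2 ^ card (block ` I)"
proof -
  have "structures = sign_structure ` Pow (block ` I)"
    using structure_eq_sign_structure sign_structure_in_structures by blast
  moreover have "inj_on sign_structure (Pow (block ` I))"
  proof (rule inj_onI)
    fix A B assume sub: "A \<in> Pow (block ` I)" "B \<in> Pow (block ` I)"
      and eq: "sign_structure A = sign_structure B"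
    have "block j \<in> A \<longleftrightarrow> block j \<in> B" if j: "j \<in> I" for j
    proof -
      obtain u where u: "u \<in> derived (G j)" "u \<noteq> 0" using j by (rule nonzero_in_derived)
      then have "u \<in> G j" using derived_subset_G j by blast
      then have "scale (if block j \<in> A then \<i> else - \<i>) u = scale (if block j \<in> B then \<i> else - \<i>) u"
        using eq sign_structure_component[OF j] by metis
      then have "(if block j \<in> A then \<i> else - \<i>) = (if block j \<in> B then \<i> else - \<i>)"
        using u(2) by (simp only: scale_cancel_right) simp
      then show ?thesis by (auto split: if_splits simp: complex_eq_iff)
    qed
    with sub show "A = B" by blast
  qed
  ultimately show ?thesis
    using finite_index by (simp add: card_image card_Pow)
qed

end

section \<open>Existence of the metric\<close>

lemma hermitian_metric_of_functionals:
  fixes scale :: "complex \<Rightarrow> 'a::ab_group_add \<Rightarrow> 'a" and f :: "'b \<Rightarrow> 'a \<Rightarrow> complex"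
  assumes "vector_space scale" and fin: "finite A"
    and add: "\<And>a x y. f a (x + y) = f a x + f a y" and hom: "\<And>a c x. f a (scale c x) = c * f a x"
    and sep: "\<And>x. x \<noteq> 0 \<Longrightarrow> \<exists>a\<in>A. f a x \<noteq> 0"
  defines "ip \<equiv> \<lambda>x y. \<Sum>a\<in>A. Re (cnj (f a x) * f a y)"
  shows "inner_product (restrict_scalars scale) ip" and "ip (scale \<i> x) (scale \<i> y) = ip x y"
proof -
  interpret vector_space scale by fact
  have vs: "vector_space (restrict_scalars scale)" "vector_space ((*) :: real \<Rightarrow> real \<Rightarrow> real)"
    by unfold_locales
      (simp_all add: restrict_scalars_def scale_right_distrib scale_left_distrib algebra_simps)
  have "ip x x > 0" if x: "x \<noteq> 0" for x
  proof -
    obtain a where "a \<in> A" "f a x \<noteq> 0" using sep[OF x] by blast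
    then show ?thesis
      unfolding ip_def
      by (intro sum_pos2[OF fin, of a])
        (auto simp: complex_eq_iff add_pos_nonneg add_nonneg_pos power2_eq_square[symmetric]
          sum_power2_gt_zero_iff)
  qed
  then show "inner_product (restrict_scalars scale) ip"
    using vs
    by (auto simp: inner_product_def bilinear_map_def Vector_Spaces.linear_iff ip_def add hom
        restrict_scalars_def sum.distrib[symmetric] sum_distrib_left algebra_simps intro!: sum.cong)
  show "ip (scale \<i> x) (scale \<i> y) = ip x y"
    by (simp add: ip_def hom add.commute)
qed

context nonabelian_decomposition
begin

text \<open>The coordinate functionals of all components give a metric in which the summands \<open>\<gg>\<^sub>j\<close> are pairwise
  orthogonal. One more functional per block, which takes the value \<open>1\<close> at a chosen vector \<open>e\<^sub>j\<close>
  of each derived algebra in the block and vanishes on the other blocks, makes the vectors \<open>e\<^sub>j\<close> of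
  one block non-orthogonal and keeps different blocks orthogonal.\<close>

lemma block_metric_exists:
  fixes block :: "'i \<Rightarrow> 'm"
  shows "\<exists>ip. block_metric scale bracket I G ip block"
proof -
  obtain B where fd: "finite_dimensional_vector_space scale B"
    using basis_exists by blast
  have B: "independent B" and finB: "finite B" and spanB: "span B = UNIV"
    using finite_dimensional_vector_space.independent_Basis[OF fd]
      finite_dimensional_vector_space.finite_Basis[OF fd]
      finite_dimensional_vector_space.span_Basis[OF fd] by simp_all
  define \<phi> where "\<phi> b x = representation B x b" for b x
  have \<phi>: "\<phi> b (x + y) = \<phi> b x + \<phi> b y" "\<phi> b (scale c x) = c * \<phi> b x" for b x y c
    using spanB by (simp_all add: \<phi>_def representation_add[OF B] representation_scale[OF B])
  have \<phi>0 [simp]: "\<phi> b 0 = 0" for b using \<phi>(2)[of b 0 0] by simp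
  have \<phi>sep: "\<exists>b\<in>B. \<phi> b x \<noteq> 0" if "x \<noteq> 0" for x
  proof (rule ccontr)
    assume "\<not> ?thesis"
    then have "(\<Sum>b\<in>B. scale (representation B x b) b) = 0" by (simp add: \<phi>_def)
    then show False
      using that sum_representation_eq[OF B _ finB order_refl, of x] spanB by simp
  qed
  have "\<forall>j\<in>I. \<exists>e b. e \<in> derived (G j) \<and> \<phi> b e = 1"
  proof
    fix j assume "j \<in> I"
    then obtain u where u: "u \<in> derived (G j)" "u \<noteq> 0" by (rule nonzero_in_derived)
    obtain b where b: "\<phi> b u \<noteq> 0" using \<phi>sep[OF u(2)] by blast
    show "\<exists>e b. e \<in> derived (G j) \<and> \<phi> b e = 1"
      by (intro exI[of _ "scale (inverse (\<phi> b u)) u"] exI[of _ b])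
        (simp add: \<phi> b u(1) subspace_scale subspace_derived)
  qed
  then obtain e \<beta> where e: "\<And>j. j \<in> I \<Longrightarrow> e j \<in> derived (G j)" "\<And>j. j \<in> I \<Longrightarrow> \<phi> (\<beta> j) (e j) = 1"
    by metis
  define f :: "('i \<times> 'a) + 'm \<Rightarrow> 'a \<Rightarrow> complex" where
    "f = case_sum (\<lambda>(j, b) x. if j \<in> I then \<phi> b (proj j x) else 0)
      (\<lambda>m x. \<Sum>j\<in>{j\<in>I. block j = m}. \<phi> (\<beta> j) (proj j x))"
  let ?A = "(I \<times> B) <+> (block ` I)"
  define ip where "ip x y = (\<Sum>a\<in>?A. Re (cnj (f a x) * f a y))" for x y
  have fin: "finite ?A" using finite_index finB by simp
  have fadd: "f a (x + y) = f a x + f a y" for a x y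
    by (cases a) (auto simp: f_def \<phi> proj_apply(1) sum.distrib)
  have fhom: "f a (scale c x) = c * f a x" for a c x
    by (cases a) (auto simp: f_def \<phi> proj_apply(2) sum_distrib_left)
  have fsep: "\<exists>a\<in>?A. f a x \<noteq> 0" if "x \<noteq> 0" for x
  proof -
    obtain j where "j \<in> I" "proj j x \<noteq> 0"
      using \<open>x \<noteq> 0\<close> sum_proj[of x] sum.neutral[of I "\<lambda>j. proj j x"] by metis
    then obtain b where "b \<in> B" "\<phi> b (proj j x) \<noteq> 0" using \<phi>sep by blast
    with \<open>j \<in> I\<close> show ?thesis by (intro bexI[of _ "Inl (j, b)"]) (auto simp: f_def)
  qed
  have fl: "f (Inl (k, b)) x = (if k = i then \<phi> b x else 0)" if "i \<in> I" "x \<in> G i" for k b i x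
    using that by (auto simp: f_def proj_component)
  have fr: "f (Inr m) x = (if m = block i then \<phi> (\<beta> i) x else 0)" if i: "i \<in> I" "x \<in> G i" for m i x
  proof -
    have "f (Inr m) x = (\<Sum>j\<in>{j\<in>I. block j = m}. if j = i then \<phi> (\<beta> i) x else 0)"
      using i by (auto simp: f_def proj_component intro!: sum.cong)
    then show ?thesis using finite_index i(1) by auto
  qed
  have "block_metric scale bracket I G ip block"
  proof unfold_locales
    show "inner_product (restrict_scalars scale) ip" "ip (scale \<i> x) (scale \<i> y) = ip x y" for x y
      using hermitian_metric_of_functionals[OF vector_space_axioms fin, of f] fadd fhom fsep
      unfolding ip_def by blast+
  next
    fix i j x y
    assume ij: "i \<in> I" "j \<in> I" "block i \<noteq> block j" and xy: "x \<in> G i" "y \<in> G j"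
    have "i \<noteq> j" using ij(3) by auto
    then have "f a x = 0 \<or> f a y = 0" for a
      using ij(3) by (cases a) (auto simp: fl[OF ij(1) xy(1)] fl[OF ij(2) xy(2)]
          fr[OF ij(1) xy(1)] fr[OF ij(2) xy(2)])
    then have "Re (cnj (f a x) * f a y) = 0" for a
      by (metis complex_cnj_zero mult_zero_left mult_zero_right zero_complex.sel(1))
    then show "ip x y = 0" by (simp only: ip_def sum.neutral_const)
  next
    fix i j
    assume ij: "i \<in> I" "j \<in> I" "i \<noteq> j" "block i = block j"
    have mem: "e i \<in> G i" "e j \<in> G j" using e(1) ij(1,2) derived_subset_G by blast+
    have "Re (cnj (f a (e i)) * f a (e j)) = (if a = Inr (block i) then 1 else 0)" for a
      using ij by (cases a) (auto simp: fl[OF ij(1) mem(1)] fl[OF ij(2) mem(2)]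
          fr[OF ij(1) mem(1)] fr[OF ij(2) mem(2)] e(2))
    then have "ip (e i) (e j) = 1"
      using fin ij(1) by (simp add: ip_def InrI)
    then show "\<exists>x\<in>derived (G i). \<exists>y\<in>derived (G j). ip x y \<noteq> 0"
      using e(1) ij(1,2) by (metis zero_neq_one)
  qed
  then show ?thesis by blast
qed

end

theorem theorem5p7:
  fixes scale :: "complex \<Rightarrow> 'a::ab_group_add \<Rightarrow> 'a"
    and bracket :: "'a \<Rightarrow> 'a \<Rightarrow> 'a"
    and G :: "nat \<Rightarrow> 'a set"
    and k l :: nat
  assumes "finite_dimensional_lie_algebra scale bracket"
    and "lie_algebra.direct_sum_of_ideals scale bracket {1..k} G"
    and "\<And>j. j \<in> {1..k} \<Longrightarrow> lie_algebra.indecomposable scale bracket (G j)"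
    and "\<And>j. j \<in> {1..k} \<Longrightarrow> lie_algebra.derived scale bracket (G j) \<noteq> {0}"
    and "1 \<le> l" and "l \<le> k"
  shows "\<exists>ip. inner_product (restrict_scalars scale) ip \<and>
    card {J. orthogonal_biinvariant_complex_structure (restrict_scalars scale) bracket ip J} = 2 ^ l"
proof -
  interpret finite_dimensional_lie_algebra scale bracket by fact
  interpret nonabelian_decomposition scale bracket "{1..k}" G
    using assms(2-4) by unfold_locales auto
  \<comment> \<open>the blocks are \<open>{1}, \<dots>, {l - 1}\<close> and \<open>{l, \<dots>, k}\<close>\<close>
  let ?block = "\<lambda>j. min j l"
  obtain ip where "block_metric scale bracket {1..k} G ip ?block"
    using block_metric_exists by blast
  then interpret block_metric scale bracket "{1..k}" G ip ?block .
  have "?block ` {1..k} = {1..l}"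
    using assms(5,6) by (auto simp: image_iff min_def)
  then show ?thesis using inner_product card_structures by auto
qed

end
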